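(* Let $(\varepsilon_n)_{n\ge1}$, $q$, $D$, $T$ and $Q$ be as defined in the context. Then $S := Q T Q^{-1}$ is a fixed point free contraction on the non-empty, closed, bounded, convex set $L := Q(D)$, for the usual norm $\|\cdot\|_1$ on $\ell_1$. Moreover, $$L=\left\{y\in\ell_1 : y_1=\sum_{n=2}^{\infty}y_n,\ \ \sum_{k=1}^{\infty}\left(\tfrac12-\varepsilon_k\right)y_{k+1}=\tfrac12\ \text{ and }\ \sum_{n=2}^{\infty}|y_n|\le q\right\},$$ while $$Sy=\left(1,\tfrac12(1-y_1),(1-\varepsilon_1)y_2,(1-\varepsilon_2)y_3,\dots,(1-\varepsilon_k)y_{k+1},\dots\right)\quad\text{for all } y\in L,$$ and $$\|Sy-Sz\|_1=\tfrac12|z_1-y_1|+\sum_{n=1}^{\infty}(1-\varepsilon_n)|y_{n+1}-z_{n+1}|\quad\text{for all } y,z\in L.$$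
   Context: $\ell_1$ is the Banach space of all scalar sequences $x=(x_n)_{n=1}^\infty$ with $\|x\|_1:=\sum_{n=1}^\infty|x_n|<\infty$. The sequence $(\varepsilon_n)_{n=1}^\infty$ is defined by $\varepsilon_1:=\frac14$ and, for all $n\ge1$, $\left(\frac12-\varepsilon_{n+1}\right)(1-\varepsilon_n)-\frac18=\frac34\left(\frac12-\varepsilon_n\right)$; equivalently, $\varepsilon_{n+1}=\dfrac{\varepsilon_n}{4(1-\varepsilon_n)}$. One has $0<\varepsilon_n<\frac12$ for all $n$ and $\sum_n\varepsilon_n<\infty$. Define $D:=\left\{x\in\ell_1:\sum_{k=1}^\infty\left(\frac12-\varepsilon_k\right)x_k=\frac12\ \text{and}\ \sum_{j=1}^\infty|x_j|\le q\right\}$, where $q>0$ is a fixed real number so large that $D\neq\emptyset$. The map $T:\ell_1\to\ell_1$ is $T(x):=\left(\frac12\left(1-\sum_{n=1}^\infty x_n\right),(1-\varepsilon_1)x_1,(1-\varepsilon_2)x_2,\dots,(1-\varepsilon_k)x_k,\dots\right)$. It maps $D$ into $D$. The linear injection $Q:\ell_1\to\ell_1$ is $Q(x):=\left(\sum_{n=1}^\infty x_n,x_1,x_2,\dots,x_k,\dots\right)$, with range $\{y\in\ell_1:y_1=\sum_{n=2}^\infty y_n\}$, and $Q^{-1}$, defined on this range, is $Q^{-1}(y)=(y_2,y_3,\dots)$. A map $S:L\to L$ is a contraction with respect to a norm $\|\cdot\|$ if $\|Sy-Sz\|<\|y-z\|$ for all $y,z\in L$ with $y\ne z$ (strict inequality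 only, no uniform constant). Fixed point free means that no $y\in L$ satisfies $Sy=y$. *)

theory Defs
  imports "HOL-Analysis.Analysis"
begin

(* Sequences are indexed from 0 here: "coord x n" is the term with number n + 1 of the sequence x
   in the 1-based numbering x_1, x_2, ..., and "eps n" is epsilon_{n+1}. *)

typedef (overloaded) 'a ell1 = "{x :: nat \<Rightarrow> 'a::real_normed_vector. summable (\<lambda>n. norm (x n))}"
  morphisms coord Abs_ell1
  by (rule exI[of _ "\<lambda>_. 0"]) simp

setup_lifting type_definition_ell1

lemma summable_norm_coord: "summable (\<lambda>n. norm (coord x n))"
  using coord[of x] by simp

lemma ell1_eqI: "(\<And>n. coord x n = coord y n) \<Longrightarrow> x = y"
  by (metis coord_inject ext)

instantiation ell1 :: (real_normed_vector) real_normed_vector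
begin

lift_definition zero_ell1 :: "'a ell1" is "\<lambda>_. 0"
  by simp

lift_definition plus_ell1 :: "'a ell1 \<Rightarrow> 'a ell1 \<Rightarrow> 'a ell1" is "\<lambda>x y n. x n + y n"
proof -
  fix x y :: "nat \<Rightarrow> 'a"
  assume "summable (\<lambda>n. norm (x n))" "summable (\<lambda>n. norm (y n))"
  then have "summable (\<lambda>n. norm (x n) + norm (y n))" by (simp add: summable_add)
  then show "summable (\<lambda>n. norm (x n + y n))"
    by (rule summable_comparison_test') (simp add: norm_triangle_ineq)
qed

lift_definition uminus_ell1 :: "'a ell1 \<Rightarrow> 'a ell1" is "\<lambda>x n. - x n"
  by simp

lift_definition minus_ell1 :: "'a ell1 \<Rightarrow> 'a ell1 \<Rightarrow> 'a ell1" is "\<lambda>x y n. x n - y n"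
proof -
  fix x y :: "nat \<Rightarrow> 'a"
  assume "summable (\<lambda>n. norm (x n))" "summable (\<lambda>n. norm (y n))"
  then have "summable (\<lambda>n. norm (x n) + norm (y n))" by (simp add: summable_add)
  then show "summable (\<lambda>n. norm (x n - y n))"
    by (rule summable_comparison_test') (simp add: norm_triangle_ineq4)
qed

lift_definition scaleR_ell1 :: "real \<Rightarrow> 'a ell1 \<Rightarrow> 'a ell1" is "\<lambda>c x n. c *\<^sub>R x n"
  by (simp add: summable_mult)

lift_definition norm_ell1 :: "'a ell1 \<Rightarrow> real" is "\<lambda>x. \<Sum>n. norm (x n)" .

definition sgn_ell1 :: "'a ell1 \<Rightarrow> 'a ell1" where "sgn_ell1 x = inverse (norm x) *\<^sub>R x"
definition dist_ell1 :: "'a ell1 \<Rightarrow> 'a ell1 \<Rightarrow> real" where "dist_ell1 x y = norm (x - y)"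
definition uniformity_ell1 :: "('a ell1 \<times> 'a ell1) filter"
  where "uniformity_ell1 = (INF e\<in>{0<..}. principal {(x, y). dist x y < e})"
definition open_ell1 :: "'a ell1 set \<Rightarrow> bool"
  where "open_ell1 U \<longleftrightarrow> (\<forall>x\<in>U. \<forall>\<^sub>F (x', y) in uniformity. x' = x \<longrightarrow> y \<in> U)"

instance
proof
  fix x y z :: "'a ell1" and a b :: real
  show "x + y + z = x + (y + z)" "x + y = y + x" "0 + x = x" "- x + x = 0" "x - y = x + - y"
    "a *\<^sub>R (x + y) = a *\<^sub>R x + a *\<^sub>R y" "(a + b) *\<^sub>R x = a *\<^sub>R x + b *\<^sub>R x"
    "a *\<^sub>R b *\<^sub>R x = (a * b) *\<^sub>R x" "1 *\<^sub>R x = x"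
    by (transfer; simp add: fun_eq_iff algebra_simps)+
  show "sgn x = inverse (norm x) *\<^sub>R x" by (rule sgn_ell1_def)
  show "dist x y = norm (x - y)" by (rule dist_ell1_def)
  show "(uniformity :: ('a ell1 \<times> 'a ell1) filter) = (INF e\<in>{0<..}. principal {(x, y). dist x y < e})"
    by (rule uniformity_ell1_def)
  show "open U \<longleftrightarrow> (\<forall>x\<in>U. \<forall>\<^sub>F (x', y) in uniformity. x' = x \<longrightarrow> y \<in> U)" for U :: "'a ell1 set"
    by (rule open_ell1_def)
  show "norm x = 0 \<longleftrightarrow> x = 0"
    by transfer (auto simp: suminf_eq_zero_iff fun_eq_iff)
  show "norm (x + y) \<le> norm x + norm y"
  proof -
    have "(\<Sum>n. norm (coord (x + y) n)) \<le> (\<Sum>n. norm (coord x n) + norm (coord y n))"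
      by (intro suminf_le summable_add summable_norm_coord)
         (simp add: plus_ell1.rep_eq norm_triangle_ineq)
    also have "\<dots> = norm x + norm y"
      by (simp add: norm_ell1.rep_eq suminf_add summable_norm_coord)
    finally show ?thesis by (simp add: norm_ell1.rep_eq)
  qed
  show "norm (a *\<^sub>R x) = \<bar>a\<bar> * norm x"
    by transfer (simp add: suminf_mult)
qed

end

lemma norm_coord_le: "norm (coord x n) \<le> norm x"
proof -
  have "(\<Sum>i\<in>{n}. norm (coord x i)) \<le> (\<Sum>i. norm (coord x i))"
    by (rule sum_le_suminf[OF summable_norm_coord]) auto
  then show ?thesis by (simp add: norm_ell1.rep_eq)
qed

instance ell1 :: (banach) banach
proof
  fix X :: "nat \<Rightarrow> 'a ell1"
  assume X: "Cauchy X"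
  have "Cauchy (\<lambda>m. coord (X m) i)" for i
  proof (rule CauchyI)
    fix e :: real assume "0 < e"
    then obtain M where M: "\<forall>m\<ge>M. \<forall>n\<ge>M. norm (X m - X n) < e"
      using CauchyD[OF X] by blast
    have "norm (coord (X m) i - coord (X n) i) \<le> norm (X m - X n)" for m n
      using norm_coord_le[of "X m - X n" i] by (simp add: minus_ell1.rep_eq)
    then show "\<exists>M. \<forall>m\<ge>M. \<forall>n\<ge>M. norm (coord (X m) i - coord (X n) i) < e"
      using M by (meson le_less_trans)
  qed
  then have "\<forall>i. \<exists>l. (\<lambda>m. coord (X m) i) \<longlonglongrightarrow> l"
    by (simp add: Cauchy_convergent_iff convergent_def)
  then obtain l where l: "\<And>i. (\<lambda>m. coord (X m) i) \<longlonglongrightarrow> l i" by metis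
  have bound: "(\<Sum>i<k. norm (coord (X m) i - l i)) \<le> e"
    if M: "\<forall>m\<ge>M. \<forall>n\<ge>M. norm (X m - X n) < e" and m: "m \<ge> M" for M m k e
  proof (rule tendsto_upperbound)
    show "(\<lambda>n. \<Sum>i<k. norm (coord (X m) i - coord (X n) i)) \<longlonglongrightarrow> (\<Sum>i<k. norm (coord (X m) i - l i))"
      by (intro tendsto_intros l)
    have "(\<Sum>i<k. norm (coord (X m) i - coord (X n) i)) \<le> norm (X m - X n)" for n
      using sum_le_suminf[OF summable_norm_coord, of "{..<k}" "X m - X n"]
      by (simp add: norm_ell1.rep_eq minus_ell1.rep_eq)
    then show "\<forall>\<^sub>F n in sequentially. (\<Sum>i<k. norm (coord (X m) i - coord (X n) i)) \<le> e"
      unfolding eventually_sequentially using M m by (meson le_less_trans less_imp_le)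
  qed simp
  have summ: "summable (\<lambda>i. norm (coord (X m) i - l i))"
    if M: "\<forall>m\<ge>M. \<forall>n\<ge>M. norm (X m - X n) < e" and m: "m \<ge> M" for M m e
    by (rule summableI_nonneg_bounded[where x = e]) (auto intro: bound[OF M m])
  obtain M1 where M1: "\<forall>m\<ge>M1. \<forall>n\<ge>M1. norm (X m - X n) < 1"
    using CauchyD[OF X, of 1] by auto
  have "summable (\<lambda>i. norm (l i))"
  proof (rule summable_comparison_test'[OF summable_add])
    show "summable (\<lambda>i. norm (coord (X M1) i))" by (rule summable_norm_coord)
    show "summable (\<lambda>i. norm (coord (X M1) i - l i))" by (rule summ[OF M1]) simp
    show "norm (norm (l i)) \<le> norm (coord (X M1) i) + norm (coord (X M1) i - l i)" for i
      using norm_triangle_ineq4[of "coord (X M1) i" "coord (X M1) i - l i"] by simp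
  qed
  then have cl: "coord (Abs_ell1 l) = l" by (simp add: Abs_ell1_inverse)
  have "X \<longlonglongrightarrow> Abs_ell1 l"
  proof (rule LIMSEQ_I)
    fix r :: real assume r: "0 < r"
    then obtain M where M: "\<forall>m\<ge>M. \<forall>n\<ge>M. norm (X m - X n) < r / 2"
      using CauchyD[OF X, of "r / 2"] by auto
    have "norm (X m - Abs_ell1 l) < r" if m: "m \<ge> M" for m
    proof -
      have "norm (X m - Abs_ell1 l) = (\<Sum>i. norm (coord (X m) i - l i))"
        by (simp add: norm_ell1.rep_eq minus_ell1.rep_eq cl)
      also have "\<dots> \<le> r / 2"
        by (rule suminf_le_const[OF summ[OF M m]]) (rule bound[OF M m])
      finally show ?thesis using r by simp
    qed
    then show "\<exists>no. \<forall>n\<ge>no. norm (X n - Abs_ell1 l) < r" by blast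
  qed
  then show "convergent X" by (auto simp: convergent_def)
qed

primrec eps :: "nat \<Rightarrow> real" where
  "eps 0 = 1 / 4"
| "eps (Suc n) = eps n / (4 * (1 - eps n))"

lemma eps_bounds: "0 < eps n" "eps n \<le> 1 / 4"
proof -
  have "0 < eps n \<and> eps n \<le> 1 / 4"
  proof (induction n)
    case (Suc n)
    then have "0 < 4 * (1 - eps n)" "eps n \<le> 1 / 4 * (4 * (1 - eps n))" by auto
    with Suc show ?case by (simp add: pos_divide_le_eq)
  qed simp
  then show "0 < eps n" "eps n \<le> 1 / 4" by simp_all
qed

lemma eps_recurrence: "(1 / 2 - eps (Suc n)) * (1 - eps n) - 1 / 8 = 3 / 4 * (1 / 2 - eps n)"
proof -
  have "1 - eps n \<noteq> 0" using eps_bounds(2)[of n] by simp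
  then show ?thesis by (simp add: field_simps)
qed

(* The scalar field is any complete real normed field, so that real and complex scalars are both
   covered; real coefficients act on it by scaleR. *)

definition domD :: "real \<Rightarrow> 'a::{real_normed_field,banach} ell1 set" where
  "domD q = {x. (\<Sum>k. (1 / 2 - eps k) *\<^sub>R coord x k) = 1 / 2 \<and> (\<Sum>j. norm (coord x j)) \<le> q}"

lemma domD_nonempty:
  assumes "2 \<le> q"
  shows "(domD q :: 'a::{real_normed_field,banach} ell1 set) \<noteq> {}"
proof -
  define x :: "nat \<Rightarrow> 'a" where "x = (\<lambda>n. if n = 0 then 2 else 0)"
  have "summable (\<lambda>n. norm (x n))"
    by (rule summable_finite[of "{0}"]) (auto simp: x_def)
  then have c: "coord (Abs_ell1 x) = x" by (simp add: Abs_ell1_inverse)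
  have "(\<Sum>k. (1 / 2 - eps k) *\<^sub>R x k) = (\<Sum>k\<in>{0}. (1 / 2 - eps k) *\<^sub>R x k)"
    by (rule suminf_finite) (auto simp: x_def)
  then have 1: "(\<Sum>k. (1 / 2 - eps k) *\<^sub>R x k) = 1 / 2"
    by (simp add: x_def scaleR_conv_of_real)
  have "(\<Sum>k. norm (x k)) = (\<Sum>k\<in>{0}. norm (x k))"
    by (rule suminf_finite) (auto simp: x_def)
  then have 2: "(\<Sum>k. norm (x k)) = 2" by (simp add: x_def)
  have "Abs_ell1 x \<in> domD q"
    unfolding domD_def mem_Collect_eq c 1 2 using assms by simp
  then show ?thesis by blast
qed

lemma summable_case_nat_norm:
  fixes f :: "nat \<Rightarrow> 'a::real_normed_vector"
  assumes "summable (\<lambda>n. norm (f n))"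
  shows "summable (\<lambda>n. norm (case n of 0 \<Rightarrow> a | Suc k \<Rightarrow> f k))"
  using summable_Suc_iff[of "\<lambda>n. norm (case n of 0 \<Rightarrow> a | Suc k \<Rightarrow> f k)"] assms by simp

lift_definition mapT :: "'a::{real_normed_field,banach} ell1 \<Rightarrow> 'a ell1" is
  "\<lambda>x n. case n of 0 \<Rightarrow> 1 / 2 * (1 - (\<Sum>k. x k)) | Suc k \<Rightarrow> (1 - eps k) *\<^sub>R x k"
proof -
  fix x :: "nat \<Rightarrow> 'a" assume x: "summable (\<lambda>n. norm (x n))"
  have "norm ((1 - eps k) *\<^sub>R x k) \<le> norm (x k)" for k
    using eps_bounds[of k] by (simp add: mult_left_le_one_le)
  then have "summable (\<lambda>k. norm ((1 - eps k) *\<^sub>R x k))"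
    by (intro summable_comparison_test'[OF x]) simp
  then show "summable (\<lambda>n. norm (case n of 0 \<Rightarrow> 1 / 2 * (1 - (\<Sum>k. x k)) | Suc k \<Rightarrow> (1 - eps k) *\<^sub>R x k))"
    by (rule summable_case_nat_norm)
qed

lift_definition mapQ :: "'a::{real_normed_field,banach} ell1 \<Rightarrow> 'a ell1" is
  "\<lambda>x n. case n of 0 \<Rightarrow> (\<Sum>k. x k) | Suc k \<Rightarrow> x k"
  by (simp add: summable_case_nat_norm)

lemma inj_mapQ: "inj mapQ"
proof (rule injI, rule ell1_eqI)
  fix x y :: "'a ell1" and n
  assume "mapQ x = mapQ y"
  then have "coord (mapQ x) (Suc n) = coord (mapQ y) (Suc n)" by simp
  then show "coord x n = coord y n" by (simp add: mapQ.rep_eq)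
qed

definition setL :: "real \<Rightarrow> 'a::{real_normed_field,banach} ell1 set" where
  "setL q = mapQ ` domD q"

(* "inv mapQ" is the inverse of the injection mapQ; it is meaningful on the range of mapQ only,
   and so mapS is meaningful there only. *)
definition mapS :: "'a::{real_normed_field,banach} ell1 \<Rightarrow> 'a ell1" where
  "mapS = mapQ \<circ> mapT \<circ> inv mapQ"

definition contraction_on :: "'a::real_normed_vector set \<Rightarrow> ('a \<Rightarrow> 'a) \<Rightarrow> bool" where
  "contraction_on L S \<longleftrightarrow>
     S \<in> L \<rightarrow> L \<and> (\<forall>y\<in>L. \<forall>z\<in>L. y \<noteq> z \<longrightarrow> norm (S y - S z) < norm (y - z))"

definition fixed_point_free_on :: "'a set \<Rightarrow> ('a \<Rightarrow> 'a) \<Rightarrow> bool" where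
  "fixed_point_free_on L S \<longleftrightarrow> \<not> (\<exists>y\<in>L. S y = y)"

end

theory Submission
  imports Defs
begin

text \<open>
  On \<open>D\<close> one has \<open>1 = 2 \<Sum>\<^sub>k (1/2 - \<epsilon>\<^sub>k) x\<^sub>k\<close>, so the first entry of \<open>T x\<close> is \<open>- \<Sum>\<^sub>k \<epsilon>\<^sub>k x\<^sub>k\<close>; it
  costs at most the norm that the factors \<open>1 - \<epsilon>\<^sub>k\<close> release, and the entries of \<open>T x\<close> sum to \<open>1\<close>.
  The norm of \<open>S y - S z\<close> is strictly smaller than that of \<open>y - z\<close> because each
  coordinate from the second one on is shrunk by a factor \<open>1 - \<epsilon>\<^sub>k < 1\<close>, and these coordinates
  determine \<open>y - z\<close>. A fixed point would satisfy \<open>x\<^sub>k\<^sub>+\<^sub>1 = (1 - \<epsilon>\<^sub>k) x\<^sub>k\<close>; then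
  \<open>(1 - 4/3 \<epsilon>\<^sub>k) x\<^sub>k\<close> is independent of \<open>k\<close> and tends to \<open>0\<close>, so \<open>x = 0\<close>.
\<close>

section \<open>Weighted coordinate sums on \<open>ell1\<close>\<close>

lemma summable_scaleR_coord:
  fixes x :: "'a::banach ell1"
  assumes "\<And>k. \<bar>c k\<bar> \<le> B"
  shows "summable (\<lambda>k. c k *\<^sub>R coord x k)"
  by (rule summable_comparison_test'[OF summable_mult[OF summable_norm_coord[of x], of B]])
     (simp add: mult_right_mono assms)

text \<open>Source of all continuity and linearity used below: the weights
  \<open>1 / 2 - eps k\<close> give the functional that defines \<open>domD q\<close>, the constant
  weight 1 gives coordinate 0 of \<open>mapQ\<close>.\<close>

lemma bounded_linear_suminf_scaleR_coord:
  assumes "\<And>k. \<bar>c k\<bar> \<le> B"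
  shows "bounded_linear (\<lambda>x :: 'a::banach ell1. \<Sum>k. c k *\<^sub>R coord x k)"
proof (rule bounded_linear_intro[where K = B])
  note s = summable_scaleR_coord[of c, OF assms]
  fix x y :: "'a ell1" and r :: real
  show "(\<Sum>k. c k *\<^sub>R coord (x + y) k) = (\<Sum>k. c k *\<^sub>R coord x k) + (\<Sum>k. c k *\<^sub>R coord y k)"
    using suminf_add[OF s s, of x y] by (simp add: plus_ell1.rep_eq scaleR_add_right)
  show "(\<Sum>k. c k *\<^sub>R coord (r *\<^sub>R x) k) = r *\<^sub>R (\<Sum>k. c k *\<^sub>R coord x k)"
    using suminf_scaleR_right[OF s, of r x] by (simp add: scaleR_ell1.rep_eq mult.commute)
  have le: "norm (c k *\<^sub>R coord x k) \<le> B * norm (coord x k)" for k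
    by (simp add: mult_right_mono assms)
  have sB: "summable (\<lambda>k. B * norm (coord x k))"
    by (intro summable_mult summable_norm_coord)
  have sn: "summable (\<lambda>k. norm (c k *\<^sub>R coord x k))"
    by (rule summable_comparison_test'[OF sB]) (use le in simp)
  have "norm (\<Sum>k. c k *\<^sub>R coord x k) \<le> (\<Sum>k. norm (c k *\<^sub>R coord x k))"
    by (rule summable_norm[OF sn])
  also have "\<dots> \<le> (\<Sum>k. B * norm (coord x k))"
    by (rule suminf_le[OF le sn sB])
  also have "\<dots> = norm x * B"
    by (simp add: norm_ell1.rep_eq suminf_mult summable_norm_coord)
  finally show "norm (\<Sum>k. c k *\<^sub>R coord x k) \<le> norm x * B" .
qed

lemma bounded_linear_suminf_coord: "bounded_linear (\<lambda>x :: 'a::banach ell1. \<Sum>k. coord x k)"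
  using bounded_linear_suminf_scaleR_coord[of "\<lambda>_. 1" 1] by simp

lemma summable_coord: "summable (coord (x :: 'a::banach ell1))"
  by (rule summable_norm_cancel[OF summable_norm_coord])

section \<open>The left shift and the map \<open>mapQ\<close>\<close>

lemma norm_ell1_split: "norm x = norm (coord x 0) + (\<Sum>k. norm (coord x (Suc k)))"
  using suminf_split_head[OF summable_norm_coord[of x]] by (simp add: norm_ell1.rep_eq)

text \<open>Agrees with \<open>inv mapQ\<close> on the range of \<open>mapQ\<close>, but is bounded
  and linear on all of \<open>ell1\<close>, so continuity arguments apply to it.\<close>

lift_definition shift_left :: "'a::real_normed_vector ell1 \<Rightarrow> 'a ell1" is "\<lambda>x n. x (Suc n)"
  by (subst summable_Suc_iff)

lemma norm_shift_left: "norm (shift_left x) = (\<Sum>k. norm (coord x (Suc k)))"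
  by (simp add: norm_ell1.rep_eq shift_left.rep_eq)

lemma bounded_linear_shift_left: "bounded_linear shift_left"
proof (rule bounded_linear_intro[where K = 1])
  fix x y :: "'a ell1" and r :: real
  show "shift_left (x + y) = shift_left x + shift_left y"
    "shift_left (r *\<^sub>R x) = r *\<^sub>R shift_left x"
    by (transfer, rule refl)+
  show "norm (shift_left x) \<le> norm x * 1"
    using norm_ell1_split[of x] by (simp add: norm_shift_left)
qed

lemma shift_left_mapQ [simp]: "shift_left (mapQ x) = x"
  by transfer simp

lemma coord_mapQ [simp]:
  "coord (mapQ x) 0 = (\<Sum>k. coord x k)" "coord (mapQ x) (Suc n) = coord x n"
  by (simp_all add: mapQ.rep_eq)

lemma coord_mapT [simp]:
  "coord (mapT x) 0 = 1 / 2 * (1 - (\<Sum>k. coord x k))"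
  "coord (mapT x) (Suc n) = (1 - eps n) *\<^sub>R coord x n"
  by (simp_all add: mapT.rep_eq)

text \<open>Describes the range of \<open>mapQ\<close> as the set of fixed points of the projection
  \<open>mapQ \<circ> shift_left\<close>, which can change coordinate 0 only.\<close>

lemma mapQ_shift_left: "mapQ (shift_left y) = y \<longleftrightarrow> coord y 0 = (\<Sum>n. coord y (Suc n))"
proof
  assume "coord y 0 = (\<Sum>n. coord y (Suc n))"
  then have "coord (mapQ (shift_left y)) n = coord y n" for n
    by (cases n) (simp_all add: shift_left.rep_eq)
  then show "mapQ (shift_left y) = y" by (rule ell1_eqI)
qed (metis coord_mapQ(1) shift_left.rep_eq suminf_cong)

lemma inv_mapQ [simp]: "inv mapQ (mapQ x) = x"
  by (rule inv_f_f[OF inj_mapQ])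

lemma mapS_mapQ [simp]: "mapS (mapQ x) = mapQ (mapT x)"
  by (simp add: mapS_def)

lemma norm_mapQ: "norm (mapQ x) = norm (\<Sum>k. coord x k) + norm x"
  by (simp add: norm_ell1_split[of "mapQ x"] norm_ell1.rep_eq[of x])

lemma bounded_linear_mapQ: "bounded_linear (mapQ :: 'a::{real_normed_field,banach} ell1 \<Rightarrow> 'a ell1)"
proof -
  interpret s: bounded_linear "\<lambda>x :: 'a ell1. \<Sum>k. coord x k"
    by (rule bounded_linear_suminf_coord)
  obtain K where K: "\<And>x :: 'a ell1. norm (\<Sum>k. coord x k) \<le> norm x * K"
    using s.bounded by blast
  show ?thesis
  \<comment> \<open>\<open>K\<close> pays for coordinate 0, the coordinate sum; the 1 pays for the
    tail, which is \<open>x\<close> itself.\<close>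
  proof (rule bounded_linear_intro[where K = "K + 1"])
    fix x y :: "'a ell1" and r :: real
    show "mapQ (x + y) = mapQ x + mapQ y"
    proof (rule ell1_eqI)
      show "coord (mapQ (x + y)) n = coord (mapQ x + mapQ y) n" for n
        by (cases n) (use s.add[of x y] in \<open>simp_all add: plus_ell1.rep_eq\<close>)
    qed
    show "mapQ (r *\<^sub>R x) = r *\<^sub>R mapQ x"
    proof (rule ell1_eqI)
      show "coord (mapQ (r *\<^sub>R x)) n = coord (r *\<^sub>R mapQ x) n" for n
        by (cases n) (use s.scaleR[of r x] in \<open>simp_all add: scaleR_ell1.rep_eq\<close>)
    qed
    show "norm (mapQ x) \<le> norm x * (K + 1)"
      using K[of x] by (simp add: norm_mapQ algebra_simps)
  qed
qed

section \<open>Closedness, boundedness and convexity of \<open>domD q\<close>\<close>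

lemma abs_half_minus_eps_le: "\<bar>1 / 2 - eps k\<bar> \<le> 1"
  using eps_bounds[of k] by (simp add: abs_le_iff)

lemma abs_eps_le: "\<bar>eps k\<bar> \<le> 1"
  using eps_bounds[of k] by simp

lemma domD_iff: "x \<in> domD q \<longleftrightarrow> (\<Sum>k. (1 / 2 - eps k) *\<^sub>R coord x k) = 1 / 2 \<and> norm x \<le> q"
  by (simp add: domD_def norm_ell1.rep_eq)

lemma closed_domD: "closed (domD q)"
proof -
  have "continuous_on UNIV (\<lambda>x :: 'a ell1. \<Sum>k. (1 / 2 - eps k) *\<^sub>R coord x k)"
    by (intro linear_continuous_on bounded_linear_suminf_scaleR_coord[of _ 1] abs_half_minus_eps_le)
  then have "closed {x :: 'a ell1. (\<Sum>k. (1 / 2 - eps k) *\<^sub>R coord x k) = 1 / 2 \<and> norm x \<le> q}"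
    by (intro closed_Collect_conj closed_Collect_eq closed_Collect_le continuous_intros) auto
  also have "{x :: 'a ell1. (\<Sum>k. (1 / 2 - eps k) *\<^sub>R coord x k) = 1 / 2 \<and> norm x \<le> q} = domD q"
    by (rule set_eqI) (simp only: mem_Collect_eq domD_iff)
  finally show ?thesis .
qed

lemma bounded_domD: "bounded (domD q)"
  by (auto simp: bounded_iff domD_iff)

lemma convex_domD: "convex (domD q :: 'a::{real_normed_field,banach} ell1 set)"
proof -
  let ?a = "\<lambda>x :: 'a ell1. \<Sum>k. (1 / 2 - eps k) *\<^sub>R coord x k"
  have "linear ?a"
    by (intro bounded_linear.linear bounded_linear_suminf_scaleR_coord[of _ 1] abs_half_minus_eps_le)
  then have "convex (?a -` {1 / 2})"
    by (rule convex_linear_vimage) simp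
  moreover have "domD q = ?a -` {1 / 2} \<inter> cball 0 q"
    by (auto simp: domD_iff)
  ultimately show ?thesis by (simp add: convex_Int)
qed

section \<open>Invariance of \<open>domD q\<close> under \<open>mapT\<close>\<close>

lemma suminf_half_minus_eps:
  "(\<Sum>k. (1 / 2 - eps k) *\<^sub>R coord x k)
     = (1 / 2) *\<^sub>R (\<Sum>k. coord x k) - (\<Sum>k. eps k *\<^sub>R coord (x :: 'a::banach ell1) k)"
  using suminf_diff[OF summable_scaleR_right[OF summable_coord, of "1/2" x]
      summable_scaleR_coord[of eps 1 x, OF abs_eps_le]]
    suminf_scaleR_right[OF summable_coord, of "1/2" x]
  by (simp add: scaleR_left_diff_distrib)

lemma suminf_one_minus_eps:
  "(\<Sum>k. (1 - eps k) *\<^sub>R coord x k)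
     = (\<Sum>k. coord x k) - (\<Sum>k. eps k *\<^sub>R coord (x :: 'a::banach ell1) k)"
  using suminf_diff[OF summable_coord summable_scaleR_coord[of eps 1 x, OF abs_eps_le]]
  by (simp add: scaleR_left_diff_distrib)

lemma summable_eps_norm: "summable (\<lambda>k. eps k * norm (coord x k))"
  by (rule summable_comparison_test'[OF summable_norm_coord[of x]])
     (use abs_eps_le in \<open>simp add: abs_mult mult_left_le_one_le\<close>)

text \<open>Measures the norm released by the factors \<open>1 - eps k\<close>. This loss absorbs
  the head of \<open>mapT x\<close> in \<open>mapT_domD\<close> and gives the strict inequality in
  \<open>contraction_on_mapS\<close>.\<close>

lemma suminf_one_minus_eps_norm:
  "(\<Sum>k. (1 - eps k) * norm (coord x k)) = norm x - (\<Sum>k. eps k * norm (coord x k))"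
  using suminf_diff[OF summable_norm_coord summable_eps_norm, of x x]
  by (simp add: left_diff_distrib norm_ell1.rep_eq)

lemma one_minus_suminf_domD:
  assumes "x \<in> domD q"
  shows "1 / 2 * (1 - (\<Sum>k. coord x k)) = - (\<Sum>k. eps k *\<^sub>R coord x k)"
proof -
  have "1 / 2 = (1 / 2) *\<^sub>R (\<Sum>k. coord x k) - (\<Sum>k. eps k *\<^sub>R coord x k)"
    using assms unfolding domD_iff suminf_half_minus_eps by simp
  then show ?thesis by (simp add: scaleR_conv_of_real field_simps)
qed

text \<open>The head \<open>- (\<Sum>k. eps k *\<^sub>R coord x k)\<close> doubles the loss of the
  tail, leaving the coordinate sum minus twice the weighted sum; this is twice the functional
  defining \<open>domD q\<close>. Hence \<open>mapS\<close> has coordinate 0 equal to 1 on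
  \<open>setL q\<close>.\<close>

lemma suminf_mapT_domD:
  assumes "x \<in> domD q"
  shows "(\<Sum>k. coord (mapT x) k) = 1"
proof -
  have "(\<Sum>k. coord (mapT x) k)
      = 1 / 2 * (1 - (\<Sum>k. coord x k)) + (\<Sum>k. (1 - eps k) *\<^sub>R coord x k)"
    using suminf_split_head[OF summable_coord[of "mapT x"]] by simp
  also have "\<dots> = 1 / 2 * (1 - (\<Sum>k. coord x k)) + (\<Sum>k. coord x k) - (\<Sum>k. eps k *\<^sub>R coord x k)"
    by (simp add: suminf_one_minus_eps)
  also have "\<dots> = 1"
    using one_minus_suminf_domD[OF assms] by (simp add: field_simps)
  finally show ?thesis .
qed

lemma mapT_domD:
  assumes "x \<in> domD q"
  shows "mapT x \<in> domD q"
  unfolding domD_iff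
proof
  let ?a = "\<lambda>x :: 'a ell1. \<Sum>k. (1 / 2 - eps k) *\<^sub>R coord x k"
  have a: "?a x = 1 / 2" using assms by (simp add: domD_iff)
  \<comment> \<open>The recurrence of \<open>eps\<close> turns the shifted weights into a
    combination of the old weights and a constant. Keeping \<open>eps (Suc k)\<close> folded below
    lets \<open>rec\<close> match.\<close>
  have rec: "(1 / 2 - eps (Suc k)) * (1 - eps k) = 3 / 4 * (1 / 2 - eps k) + 1 / 8" for k
    using eps_recurrence[of k] by linarith
  have sa: "summable (\<lambda>k. (1 / 2 - eps k) *\<^sub>R coord y k)" for y :: "'a ell1"
    by (rule summable_scaleR_coord[of _ 1, OF abs_half_minus_eps_le])
  have "?a (mapT x) = (1 / 2 - eps 0) *\<^sub>R coord (mapT x) 0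
      + (\<Sum>k. ((1 / 2 - eps (Suc k)) * (1 - eps k)) *\<^sub>R coord x k)"
    using suminf_split_head[OF sa[of "mapT x"]] by (simp del: eps.simps)
  also have "(\<Sum>k. ((1 / 2 - eps (Suc k)) * (1 - eps k)) *\<^sub>R coord x k)
      = (3 / 4) *\<^sub>R ?a x + (1 / 8) *\<^sub>R (\<Sum>k. coord x k)"
    using suminf_add[OF summable_scaleR_right[OF sa, of "3/4" x]
        summable_scaleR_right[OF summable_coord, of "1/8" x]]
      suminf_scaleR_right[OF sa, of "3/4" x] suminf_scaleR_right[OF summable_coord, of "1/8" x]
    by (simp add: rec scaleR_add_left del: eps.simps)
  \<comment> \<open>As \<open>eps 0 = 1 / 4\<close>, the head term is
    \<open>1 / 8 * (1 - (\<Sum>k. coord x k))\<close>: the coordinate sums cancel and 3/8 + 1/8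
    remains.\<close>
  also have "(1 / 2 - eps 0) *\<^sub>R coord (mapT x) 0
      + ((3 / 4) *\<^sub>R ?a x + (1 / 8) *\<^sub>R (\<Sum>k. coord x k)) = 1 / 2"
    unfolding a by (simp add: scaleR_conv_of_real field_simps)
  finally show "?a (mapT x) = 1 / 2" .
  have "norm (\<Sum>k. eps k *\<^sub>R coord x k) \<le> (\<Sum>k. norm (eps k *\<^sub>R coord x k))"
    using summable_eps_norm[of x] eps_bounds(1) by (intro summable_norm) (simp add: abs_of_pos)
  then have "norm (coord (mapT x) 0) \<le> (\<Sum>k. eps k * norm (coord x k))"
    using one_minus_suminf_domD[OF assms] eps_bounds(1) by (simp add: abs_of_pos)
  moreover have "(\<Sum>k. norm (coord (mapT x) (Suc k))) = norm x - (\<Sum>k. eps k * norm (coord x k))"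
    using abs_eps_le by (simp add: suminf_one_minus_eps_norm abs_le_iff)
  ultimately show "norm (mapT x) \<le> q"
    using assms norm_ell1_split[of "mapT x"] by (simp add: domD_iff)
qed

section \<open>Closedness and explicit form of \<open>setL q\<close>\<close>

lemma setL_eq_shift_left: "setL q = {y. mapQ (shift_left y) = y \<and> shift_left y \<in> domD q}"
proof -
  have "y \<in> setL q" if "mapQ (shift_left y) = y" "shift_left y \<in> domD q" for y :: "'a ell1"
    using that unfolding setL_def by (metis imageI)
  then show ?thesis by (auto simp: setL_def)
qed

text \<open>Written with \<open>shift_left\<close>, the image \<open>setL q\<close> becomes the
  fixed point set of a continuous map intersected with the preimage of a closed set.\<close>

lemma closed_setL: "closed (setL q :: 'a::{real_normed_field,banach} ell1 set)"
proof -
  have c: "continuous_on UNIV (shift_left :: 'a ell1 \<Rightarrow> 'a ell1)"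
    by (rule linear_continuous_on[OF bounded_linear_shift_left])
  have "continuous_on UNIV (\<lambda>y :: 'a ell1. mapQ (shift_left y))"
    by (rule linear_continuous_on[OF
          bounded_linear_compose[OF bounded_linear_mapQ bounded_linear_shift_left]])
  then have "closed {y :: 'a ell1. mapQ (shift_left y) = y}"
    by (intro closed_Collect_eq continuous_on_id)
  moreover have "closed (shift_left -` domD q :: 'a ell1 set)"
    using closed_vimage[OF closed_domD c] .
  ultimately show ?thesis
    unfolding setL_eq_shift_left Collect_conj_eq by (auto simp: vimage_def)
qed

lemma setL_eq:
  "setL q = {y. coord y 0 = (\<Sum>n. coord y (Suc n))
               \<and> (\<Sum>k. (1 / 2 - eps k) *\<^sub>R coord y (Suc k)) = 1 / 2
               \<and> (\<Sum>n. norm (coord y (Suc n))) \<le> q}"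
  unfolding setL_eq_shift_left mapQ_shift_left domD_iff norm_shift_left shift_left.rep_eq ..

section \<open>Explicit form and contractivity of \<open>mapS\<close>\<close>

lemma coord_mapS:
  assumes "y \<in> setL q"
  shows "coord (mapS y) =
           (\<lambda>n. case n of 0 \<Rightarrow> 1
                 | Suc 0 \<Rightarrow> 1 / 2 * (1 - coord y 0)
                 | Suc (Suc k) \<Rightarrow> (1 - eps k) *\<^sub>R coord y (Suc k))"
proof -
  obtain x where x: "x \<in> domD q" and y: "y = mapQ x"
    using assms by (auto simp: setL_def)
  show ?thesis
    \<comment> \<open>Coordinate 0 is the coordinate sum of \<open>mapT x\<close>, which is 1;
      coordinate 1 is the head of \<open>mapT x\<close>, where the sum over \<open>x\<close> is
      \<open>coord y 0\<close>.\<close>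
    by (rule ext) (simp add: y suminf_mapT_domD[OF x] split: nat.split)
qed

lemma norm_mapS_diff:
  assumes "y \<in> setL q" "z \<in> setL q"
  shows "norm (mapS y - mapS z) = 1 / 2 * norm (coord z 0 - coord y 0)
           + (\<Sum>n. (1 - eps n) * norm (coord y (Suc n) - coord z (Suc n)))"
proof -
  let ?d = "mapS y - mapS z"
  have c: "coord ?d n = coord (mapS y) n - coord (mapS z) n" for n
    by (simp add: minus_ell1.rep_eq)
  \<comment> \<open>Two heads are split off: coordinate 0 vanishes because both images have 1 there,
    and coordinate 1 gives the halved term.\<close>
  have "norm ?d = norm (coord ?d 0) + norm (coord (shift_left ?d) 0)
      + (\<Sum>n. norm (coord (shift_left ?d) (Suc n)))"
    using norm_ell1_split[of ?d] norm_ell1_split[of "shift_left ?d"] by (simp add: norm_shift_left)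
  moreover have "coord ?d 0 = 0"
    by (simp add: c coord_mapS[OF assms(1)] coord_mapS[OF assms(2)])
  moreover have "coord (shift_left ?d) 0 = 1 / 2 * (coord z 0 - coord y 0)"
    by (simp add: shift_left.rep_eq c coord_mapS[OF assms(1)] coord_mapS[OF assms(2)] diff_divide_distrib)
  moreover have "norm (coord (shift_left ?d) (Suc n))
      = (1 - eps n) * norm (coord y (Suc n) - coord z (Suc n))" for n
    using eps_bounds[of n]
    by (simp add: shift_left.rep_eq c coord_mapS[OF assms(1)] coord_mapS[OF assms(2)]
        flip: scaleR_diff_right)
  ultimately show ?thesis by (simp add: norm_mult norm_divide)
qed

lemma mapS_setL:
  assumes "y \<in> setL q"
  shows "mapS y \<in> setL q"
  using assms unfolding setL_def by (auto intro!: imageI mapT_domD)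

lemma contraction_on_mapS:
  "contraction_on (setL q :: 'a::{real_normed_field,banach} ell1 set) mapS"
  unfolding contraction_on_def
proof (intro conjI ballI impI)
  fix y z :: "'a ell1" assume y: "y \<in> setL q" and z: "z \<in> setL q" and "y \<noteq> z"
  define d where "d = shift_left (y - z)"
  \<comment> \<open>The range of \<open>mapQ\<close> is a linear subspace, so \<open>y - z\<close>
    is recovered from its tail \<open>d\<close>, and \<open>d = 0\<close> would force
    \<open>y = z\<close>.\<close>
  have "mapQ d = y - z"
    using y z linear_diff[OF bounded_linear.linear[OF bounded_linear_shift_left], of y z]
      linear_diff[OF bounded_linear.linear[OF bounded_linear_mapQ], of "shift_left y" "shift_left z"]
    by (simp add: d_def setL_eq_shift_left)
  moreover have "mapQ 0 = (0 :: 'a ell1)"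
    by (rule linear_0[OF bounded_linear.linear[OF bounded_linear_mapQ]])
  ultimately have "d \<noteq> 0" using \<open>y \<noteq> z\<close> by auto
  then obtain n where "coord d n \<noteq> 0"
    by (metis ell1_eqI zero_ell1.rep_eq)
  then have "0 < eps n * norm (coord d n)"
    using eps_bounds(1) by simp
  then have "0 < (\<Sum>k. eps k * norm (coord d k))"
    using eps_bounds(1) by (intro suminf_pos2[OF summable_eps_norm, of d n]) (simp_all add: less_imp_le)
  moreover have "norm (mapS y - mapS z)
      = 1 / 2 * norm (coord (y - z) 0) + (norm d - (\<Sum>k. eps k * norm (coord d k)))"
    unfolding norm_mapS_diff[OF y z] suminf_one_minus_eps_norm[symmetric]
    by (simp add: d_def shift_left.rep_eq minus_ell1.rep_eq norm_minus_commute)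
  moreover have "norm (y - z) = norm (coord (y - z) 0) + norm d"
    unfolding d_def norm_shift_left by (rule norm_ell1_split)
  ultimately show "norm (mapS y - mapS z) < norm (y - z)"
    using norm_ge_zero[of "coord (y - z) 0"] by linarith
qed (simp add: mapS_setL)

section \<open>Absence of fixed points\<close>

lemma ell1_eq_0_if_eps_recurrence:
  fixes x :: "'a::real_normed_vector ell1"
  assumes "\<And>k. coord x (Suc k) = (1 - eps k) *\<^sub>R coord x k"
  shows "x = 0"
proof (rule ell1_eqI)
  \<comment> \<open>An integrating factor: \<open>eps (Suc k) * (1 - eps k) = eps k / 4\<close>, so
    \<open>1 - c * eps k\<close> satisfies \<open>w (Suc k) * (1 - eps k) = w k\<close> exactly when
    c = 1 + c/4, that is c = 4/3.\<close>
  define w where "w k = 1 - 4 / 3 * eps k" for k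
  \<comment> \<open>The upper bound carries the decay of \<open>coord x k\<close> over to the
    product; the lower bound allows dividing by \<open>w k\<close> at the end.\<close>
  have w: "2 / 3 \<le> w k" "w k \<le> 1" for k
    using eps_bounds[of k] by (simp_all add: w_def)
  have "w (Suc k) * (1 - eps k) = w k" for k
    using eps_bounds(2)[of k] by (simp add: w_def field_simps)
  then have step: "w (Suc k) *\<^sub>R coord x (Suc k) = w k *\<^sub>R coord x k" for k
    by (simp add: assms)
  have const: "w k *\<^sub>R coord x k = w 0 *\<^sub>R coord x 0" for k
  proof (induction k)
    case (Suc k)
    then show ?case by (simp only: step)
  qed (rule refl)
  have "(\<lambda>k. norm (coord x k)) \<longlonglongrightarrow> 0"
    by (rule summable_LIMSEQ_zero[OF summable_norm_coord])
  moreover have "norm (w k *\<^sub>R coord x k) \<le> norm (coord x k)" for k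
    using w[of k] by (simp add: mult_left_le_one_le)
  ultimately have "(\<lambda>k. w k *\<^sub>R coord x k) \<longlonglongrightarrow> 0"
    by (rule Lim_null_comparison[OF always_eventually[OF allI], rotated])
  moreover have "(\<lambda>k. w k *\<^sub>R coord x k) = (\<lambda>_. w 0 *\<^sub>R coord x 0)"
    by (rule ext) (rule const)
  ultimately have "w 0 *\<^sub>R coord x 0 = 0"
    by (simp only: LIMSEQ_const_iff)
  then have "w k *\<^sub>R coord x k = 0" for k
    by (simp only: const[of k])
  moreover have "w k \<noteq> 0" for k
    using w(1)[of k] by auto
  ultimately show "coord x k = coord 0 k" for k
    by (simp add: zero_ell1.rep_eq)
qed

lemma fixed_point_free_mapS:
  "fixed_point_free_on (setL q :: 'a::{real_normed_field,banach} ell1 set) mapS"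
  unfolding fixed_point_free_on_def setL_def
proof
  assume "\<exists>y\<in>mapQ ` domD q. mapS y = (y :: 'a ell1)"
  then obtain x :: "'a ell1" where x: "x \<in> domD q" and "mapS (mapQ x) = mapQ x"
    by blast
  then have "mapT x = x"
    using injD[OF inj_mapQ, of "mapT x" x] by simp
  have "coord x (Suc k) = (1 - eps k) *\<^sub>R coord x k" for k
    using coord_mapT(2)[of x k] by (simp only: \<open>mapT x = x\<close>)
  then have "x = 0"
    by (rule ell1_eq_0_if_eps_recurrence)
  \<comment> \<open>At 0 the functional defining \<open>domD q\<close> is 0 instead of 1/2.\<close>
  with x show False
    by (simp add: domD_iff zero_ell1.rep_eq)
qed

theorem theorem4p3:
  fixes q :: real and L :: "'a::{real_normed_field,banach} ell1 set"
  assumes "q > 0"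
    and "(domD q :: 'a ell1 set) \<noteq> {}"
    and "L = setL q"
  shows "L \<noteq> {} \<and> closed L \<and> bounded L \<and> convex L
    \<and> contraction_on L mapS
    \<and> fixed_point_free_on L mapS
    \<and> L = {y. coord y 0 = (\<Sum>n. coord y (Suc n))
               \<and> (\<Sum>k. (1 / 2 - eps k) *\<^sub>R coord y (Suc k)) = 1 / 2
               \<and> (\<Sum>n. norm (coord y (Suc n))) \<le> q}
    \<and> (\<forall>y\<in>L. coord (mapS y) =
           (\<lambda>n. case n of 0 \<Rightarrow> 1
                 | Suc 0 \<Rightarrow> 1 / 2 * (1 - coord y 0)
                 | Suc (Suc k) \<Rightarrow> (1 - eps k) *\<^sub>R coord y (Suc k)))
    \<and> (\<forall>y\<in>L. \<forall>z\<in>L. norm (mapS y - mapS z) =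
           1 / 2 * norm (coord z 0 - coord y 0)
           + (\<Sum>n. (1 - eps n) * norm (coord y (Suc n) - coord z (Suc n))))"
proof (intro conjI ballI)
  \<comment> \<open>These three pass to the image under the bounded linear \<open>mapQ\<close>;
    closedness does not do so in general and comes from \<open>closed_setL\<close>.\<close>
  show "L \<noteq> {}" "bounded L" "convex L"
    using assms(2) bounded_linear_image[OF bounded_domD bounded_linear_mapQ]
      convex_linear_image[OF bounded_linear.linear[OF bounded_linear_mapQ] convex_domD]
    by (simp_all add: assms(3) setL_def)
  show "L = {y. coord y 0 = (\<Sum>n. coord y (Suc n))
               \<and> (\<Sum>k. (1 / 2 - eps k) *\<^sub>R coord y (Suc k)) = 1 / 2
               \<and> (\<Sum>n. norm (coord y (Suc n))) \<le> q}"
    unfolding assms(3) by (rule setL_eq)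
qed (simp_all only: assms(3) closed_setL contraction_on_mapS fixed_point_free_mapS
      coord_mapS norm_mapS_diff)

end
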